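(* Let $g(x)$ be a formal power series with $g_0\ne0$, $g(x)\ne-1$, such that the Riordan array $(1,xg(x))$ is a pseudo-involution, and let $B(x)=\sum_{i\ge0}b_ix^i$ be the generating function of its $B$-sequence, i.e. $g(x)=1+xg(x)B(x^2g(x))$. Put $s(x)=\sum_{i\ge0}\frac{b_i}{2}x^{2i+1}$ and $h(x)=s(x)+\sqrt{s^2(x)+1}$. Then $h(x)$ is the generating function of the $A$-sequence of $(1,x\sqrt{g(x)})$ (i.e. $\sqrt{g(x)}=h(x\sqrt{g(x)})$), and for every positive integer $m$ and $n\ge1$, with $p=\lfloor(n-1)/2\rfloor$ and sums over all tuples $(m_0,\dots,m_p)$ of nonnegative integers with $n=\sum_{i=0}^pm_i(2i+1)$, $q=\sum_{i=0}^pm_i$, and $p_q(m)=m\prod_{i=1}^{q-1}(m+q-2i)$: $$[x^n]h^m(x)=\sum\frac{p_q(m)}{m_0!\,m_1!\cdots m_p!}\,\frac{1}{2^q}\,b_0^{m_0}b_1^{m_1}\cdots b_p^{m_p},$$ $$[x^n]g^{m/2}(x)=\sum\frac{m\,p_q(m+n)}{(m+n)\,m_0!\,m_1!\cdots m_p!}\,\frac{1}{2^q}\,b_0^{m_0}b_1^{m_1}\cdots b_p^{m_p}.$$ In this sense the expansion of the coefficients of $g^m(x)$ in terms of the $B$-sequence is an expansion of generalized binomial type.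
   Context: For formal power series $f(x)$ and $\phi(x)$ with $\phi_0=0$, the Riordan array $(f(x),\phi(x))$ is the infinite lower-triangular matrix whose $n$th column has generating function $f(x)\phi^n(x)$; it acts by $(f,\phi)a(x)=f(x)a(\phi(x))$. The array $(1,xg(x))$ is a pseudo-involution if $(1,xg(x))^{-1}=(1,xg(-x))$. The $A$-sequence of $(1,xG(x))$, $G_0\ne0$, has generating function $A(x)$ characterized by $G(x)=A(xG(x))$, equivalently $(1,xG(x))^{-1}=(1,x/A(x))$. $[x^n]F$ is the coefficient of $x^n$ in $F$; square roots and powers $g^{m/2}$ of power series with constant term $1$ are the power series with constant term $1$. An expansion of generalized binomial type (with parameter $\varphi$) means: if the $A$-sequence ${}_{(\varphi)}A(x)$ of $(1,xg^{\varphi}(x))$ satisfies $[x^n]\,{}_{(\varphi)}A^m(x)=\sum \frac{p_q(m)}{m_1!\cdots}f_1^{m_1}\cdots$, then $[x^n]g^m(x)=\sum\frac{(m/\varphi)\,p_q((m/\varphi)+n)}{((m/\varphi)+n)\,m_1!\cdots}f_1^{m_1}\cdots$; here $\varphi=1/2$. *)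

theory Defs
  imports
    "HOL-Computational_Algebra.Formal_Power_Series"
    "HOL-Library.FuncSet"
begin

unbundle fps_syntax

(* Infinite matrices are functions of (row, column).  The product below is the matrix
   product when the left factor M is lower triangular: then M n j = 0 for j > n. *)

type_synonym 'a inf_matrix = "nat \<Rightarrow> nat \<Rightarrow> 'a"

definition inf_matrix_id :: "'a::comm_ring_1 inf_matrix" where
  "inf_matrix_id = (\<lambda>n k. if n = k then 1 else 0)"

definition lower_tri_mult ::
    "'a::comm_ring_1 inf_matrix \<Rightarrow> 'a inf_matrix \<Rightarrow> 'a inf_matrix" where
  "lower_tri_mult M N = (\<lambda>n k. \<Sum>j\<le>n. M n j * N j k)"

definition lower_tri_inverse :: "'a::comm_ring_1 inf_matrix \<Rightarrow> 'a inf_matrix \<Rightarrow> bool" where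
  "lower_tri_inverse M N \<longleftrightarrow>
     lower_tri_mult M N = inf_matrix_id \<and> lower_tri_mult N M = inf_matrix_id"

definition riordan :: "'a::comm_ring_1 fps \<Rightarrow> 'a fps \<Rightarrow> 'a inf_matrix" where
  "riordan f \<phi> = (\<lambda>n k. (f * \<phi> ^ k) $ n)"

lemma riordan_lower_triangular:
  fixes f \<phi> :: "'a::idom fps"
  assumes "\<phi> $ 0 = 0" "n < k"
  shows "riordan f \<phi> n k = 0"
proof -
  have "(\<phi> ^ k) $ i = 0" if "i < k" for i
    using startsby_zero_power_prefix[OF assms(1)] that by blast
  then show ?thesis
    using assms(2) by (auto simp: riordan_def fps_mult_nth intro!: sum.neutral)
qed

definition pseudo_involution :: "'a::comm_ring_1 fps \<Rightarrow> bool" where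
  "pseudo_involution g \<longleftrightarrow>
     lower_tri_inverse (riordan 1 (fps_X * g)) (riordan 1 (fps_X * (g oo (- fps_X))))"

definition is_A_sequence :: "'a::comm_ring_1 fps \<Rightarrow> 'a fps \<Rightarrow> bool" where
  "is_A_sequence G A \<longleftrightarrow> G $ 0 \<noteq> 0 \<and> G = A oo (fps_X * G)"

definition is_B_sequence :: "'a::comm_ring_1 fps \<Rightarrow> 'a fps \<Rightarrow> bool" where
  "is_B_sequence g B \<longleftrightarrow> g = 1 + fps_X * g * (B oo (fps_X\<^sup>2 * g))"

(* Only meaningful for constant term 1; the root chosen is the one with constant term 1. *)

definition fps_sqrt :: "'a::field_char_0 fps \<Rightarrow> 'a fps" where
  "fps_sqrt F = fps_radical (\<lambda>_ _. 1) 2 F"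

lemma fps_sqrt_nth_0: "fps_sqrt F $ 0 = 1"
  by (simp add: fps_sqrt_def)

lemma fps_sqrt_power2:
  assumes "F $ 0 = 1"
  shows "(fps_sqrt F)\<^sup>2 = F"
  using power_radical[of F "\<lambda>_ _. 1" 1] assms
  by (simp add: fps_sqrt_def numeral_2_eq_2)

lemma fps_sqrt_unique:
  assumes "S\<^sup>2 = F" "S $ 0 = 1"
  shows "S = fps_sqrt F"
proof -
  have "F $ 0 = 1"
    using assms by (auto simp: fps_power_zeroth)
  then show ?thesis
    using radical_unique[of "\<lambda>_ _. 1" 1 F S] assms
    by (simp add: fps_sqrt_def numeral_2_eq_2)
qed

(* F^a for constant term 1, by substituting F - 1 into the binomial series (1 + x)^a. *)

definition fps_cpow :: "'a::field_char_0 fps \<Rightarrow> 'a \<Rightarrow> 'a fps" where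
  "fps_cpow F a = fps_binomial a oo (F - 1)"

lemma fps_cpow_half:
  assumes "F $ 0 = 1"
  shows "fps_cpow F (of_nat m / 2) = fps_sqrt F ^ m"
proof -
  have z: "(F - 1) $ 0 = 0"
    using assms by simp
  have "(fps_cpow F (1/2))\<^sup>2 = fps_binomial 1 oo (F - 1)"
    by (simp add: fps_cpow_def fps_compose_power[OF z] fps_binomial_power)
  also have "\<dots> = F"
    using fps_binomial_of_nat[of 1, where 'a = 'a] z
    by (simp add: fps_compose_add_distrib)
  finally have "fps_cpow F (1/2) = fps_sqrt F"
    by (rule fps_sqrt_unique) (simp add: fps_cpow_def)
  moreover have "fps_cpow F (of_nat m / 2) = fps_cpow F (1/2) ^ m"
    by (simp add: fps_cpow_def fps_compose_power[OF z] fps_binomial_power)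
  ultimately show ?thesis
    by simp
qed

definition weighted_tuples :: "nat set \<Rightarrow> (nat \<Rightarrow> nat) \<Rightarrow> nat \<Rightarrow> (nat \<Rightarrow> nat) set" where
  "weighted_tuples I w n = {\<mu> \<in> I \<rightarrow>\<^sub>E UNIV. (\<Sum>i\<in>I. \<mu> i * w i) = n}"

lemma finite_weighted_tuples:
  assumes "finite I" "\<And>i. i \<in> I \<Longrightarrow> w i > 0"
  shows "finite (weighted_tuples I w n)"
proof (rule finite_subset)
  show "weighted_tuples I w n \<subseteq> I \<rightarrow>\<^sub>E {..n}"
  proof
    fix \<mu> assume \<mu>: "\<mu> \<in> weighted_tuples I w n"
    have "\<mu> i \<le> n" if i: "i \<in> I" for i
    proof -
      have "\<mu> i \<le> \<mu> i * w i"
        using assms(2)[OF i] by simp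
      also have "\<dots> \<le> (\<Sum>i\<in>I. \<mu> i * w i)"
        by (rule member_le_sum[OF i _ assms(1)]) simp
      also have "\<dots> = n"
        using \<mu> by (simp add: weighted_tuples_def)
      finally show ?thesis .
    qed
    then show "\<mu> \<in> I \<rightarrow>\<^sub>E {..n}"
      using \<mu> by (auto simp: weighted_tuples_def PiE_iff)
  qed
  show "finite (I \<rightarrow>\<^sub>E {..n})"
    using assms(1) by (intro finite_PiE) auto
qed

(* The expansion of the coefficients of g^m in the quantities f i, where f i carries the
   weight w i (so that n = sum of \<mu> i * w i), is of generalized binomial type with
   parameter \<phi> and polynomials p q: both the expansion of the powers of the A-sequence of
   (1, x g^\<phi>) and the resulting expansion of the powers of g hold. *)

definition generalized_binomial_type ::
    "'a::field_char_0 \<Rightarrow> 'a fps \<Rightarrow> (nat \<Rightarrow> nat) \<Rightarrow> (nat \<Rightarrow> 'a) \<Rightarrow> (nat \<Rightarrow> 'a \<Rightarrow> 'a) \<Rightarrow> bool" where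
  "generalized_binomial_type \<phi> g w f p \<longleftrightarrow>
     (\<exists>A. is_A_sequence (fps_cpow g \<phi>) A \<and>
       (\<forall>m::nat. \<forall>n::nat. m \<ge> 1 \<longrightarrow> n \<ge> 1 \<longrightarrow>
         (let I = {i. w i \<le> n} in
           (A ^ m) $ n =
             (\<Sum>\<mu>\<in>weighted_tuples I w n.
                p (\<Sum>i\<in>I. \<mu> i) (of_nat m) / (\<Prod>i\<in>I. fact (\<mu> i)) * (\<Prod>i\<in>I. f i ^ \<mu> i)) \<and>
           (g ^ m) $ n =
             (\<Sum>\<mu>\<in>weighted_tuples I w n.
                (of_nat m / \<phi>) * p (\<Sum>i\<in>I. \<mu> i) (of_nat m / \<phi> + of_nat n) /
                ((of_nat m / \<phi> + of_nat n) * (\<Prod>i\<in>I. fact (\<mu> i))) * (\<Prod>i\<in>I. f i ^ \<mu> i)))))"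

definition p_poly :: "nat \<Rightarrow> 'a::field_char_0 \<Rightarrow> 'a" where
  "p_poly q m = m * (\<Prod>i=1..<q. m + of_nat q - 2 * of_nat i)"

end

theory Submission
  imports Defs
begin

text \<open>
  With \<open>r = \<surd>g\<close> and \<open>u = x r\<close> the equation of the \<open>B\<close>-sequence reads \<open>r - 1/r = u B(u\<^sup>2) = 2 s(u)\<close>;
  solving the quadratic equation for \<open>r\<close> gives \<open>r = h(u)\<close>. The coefficients of
  \<open>(y + \<surd>(y\<^sup>2 + 1))\<^sup>m\<close> are \<open>p\<^sub>q(m) / q!\<close>, so substituting \<open>y = s\<close> and expanding \<open>s\<^sup>q\<close> by the
  multinomial theorem gives the coefficients of \<open>h\<^sup>m\<close>. Lagrange inversion,
  \<open>(m + n) [x\<^sup>n] r\<^sup>m = m [x\<^sup>n] h\<^bsup>m+n\<^esup>\<close>, transfers this to the powers of \<open>r\<close>.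
\<close>

section \<open>Coefficients of powers and compositions as sums over weighted tuples\<close>

text \<open>Allows a series to be replaced by a polynomial truncation as long as only coefficients
  up to \<open>n\<close> matter.\<close>

lemma fps_power_nth_cong:
  fixes f g :: "'a::comm_semiring_1 fps"
  assumes "\<And>k. k \<le> n \<Longrightarrow> f $ k = g $ k" "j \<le> n"
  shows "(f ^ q) $ j = (g ^ q) $ j"
  using assms(2)
proof (induction q arbitrary: j)
  case (Suc q)
  then show ?case
    by (auto simp: fps_mult_nth assms(1) intro!: sum.cong)
qed simp

text \<open>With all weights equal to 1 the index set consists of the tuples of total
  \<open>q\<close>. Such a tuple on \<open>insert x I\<close> corresponds to its value
  \<open>k\<close> at \<open>x\<close> together with a tuple on \<open>I\<close> of total
  \<open>q - k\<close>.\<close>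

lemma sum_weighted_tuples_insert:
  assumes I: "finite I" "x \<notin> I"
  shows "sum F (weighted_tuples (insert x I) (\<lambda>_. 1) q) =
    (\<Sum>k\<le>q. \<Sum>\<mu>\<in>weighted_tuples I (\<lambda>_. 1) (q - k). F (\<mu>(x := k)))"
proof -
  let ?S = "SIGMA k:{..q}. weighted_tuples I (\<lambda>_. 1) (q - k)"
  let ?c = "\<lambda>(k, \<mu>::nat \<Rightarrow> nat). \<mu>(x := k)"
  have upd: "(\<Sum>i\<in>I. (\<mu>(x := k)) i) = (\<Sum>i\<in>I. \<mu> i)" for \<mu> :: "nat \<Rightarrow> nat" and k
    using I by (intro sum.cong) auto
  have inj: "inj_on ?c ?S"
    by (rule inj_on_subset[OF inj_combinator[OF I(2), of "\<lambda>_. UNIV"]])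
      (auto simp: weighted_tuples_def)
  have img: "?c ` ?S = weighted_tuples (insert x I) (\<lambda>_. 1) q"
  proof (intro subset_antisym subsetI)
    fix \<nu> assume "\<nu> \<in> ?c ` ?S"
    then obtain k \<mu> where "k \<le> q" "\<mu> \<in> weighted_tuples I (\<lambda>_. 1) (q - k)" "\<nu> = \<mu>(x := k)"
      by auto
    then show "\<nu> \<in> weighted_tuples (insert x I) (\<lambda>_. 1) q"
      using I upd by (auto simp: weighted_tuples_def PiE_fun_upd)
  next
    fix \<nu> assume \<nu>: "\<nu> \<in> weighted_tuples (insert x I) (\<lambda>_. 1) q"
    \<comment> \<open>Tuples are extensional, so restricting one to \<open>I\<close> means resetting
      its value at \<open>x\<close> to \<open>undefined\<close>.\<close>
    have "\<nu>(x := undefined) \<in> I \<rightarrow>\<^sub>E UNIV"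
      using \<nu> I by (intro fun_upd_in_PiE) (auto simp: weighted_tuples_def)
    moreover have "\<nu> x + (\<Sum>i\<in>I. \<nu> i) = q"
      using \<nu> I by (simp add: weighted_tuples_def)
    ultimately have "(\<nu> x, \<nu>(x := undefined)) \<in> ?S"
      using upd by (auto simp: weighted_tuples_def)
    then show "\<nu> \<in> ?c ` ?S"
      by (rule rev_image_eqI) simp
  qed
  have "sum F (weighted_tuples (insert x I) (\<lambda>_. 1) q) = (\<Sum>(k, \<mu>)\<in>?S. F (\<mu>(x := k)))"
    unfolding img[symmetric] sum.reindex[OF inj] by (simp add: comp_def case_prod_unfold)
  also have "\<dots> = (\<Sum>k\<le>q. \<Sum>\<mu>\<in>weighted_tuples I (\<lambda>_. 1) (q - k). F (\<mu>(x := k)))"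
    using I by (intro sum.Sigma[symmetric] ballI finite_weighted_tuples) auto
  finally show ?thesis .
qed

text \<open>Induction on \<open>I\<close>: the binomial theorem splits off \<open>a x ^ k\<close>,
  and the binomial coefficient times \<open>(q - k)!\<close> leaves \<open>q! / k!\<close>.\<close>

lemma fps_multinomial:
  fixes a :: "nat \<Rightarrow> 'a::field_char_0 fps"
  assumes "finite I"
  shows "(\<Sum>i\<in>I. a i) ^ q =
    (\<Sum>\<mu>\<in>weighted_tuples I (\<lambda>_. 1) q.
       fps_const (fact q / (\<Prod>i\<in>I. fact (\<mu> i))) * (\<Prod>i\<in>I. a i ^ \<mu> i))"
  using assms
proof (induction I arbitrary: q)
  case empty
  then show ?case
    by (cases q) (auto simp: weighted_tuples_def)
next
  case (insert x I)
  let ?W = "\<lambda>q. weighted_tuples I (\<lambda>_. 1) q"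
  \<comment> \<open>The target type of \<open>f\<close> stays open: the rule serves both the scalar
    factorials and the powers of series.\<close>
  have upd: "(\<Prod>i\<in>I. f ((\<mu>(x := k)) i) i) = (\<Prod>i\<in>I. f (\<mu> i) i)"
    for f :: "nat \<Rightarrow> nat \<Rightarrow> 'b::comm_monoid_mult" and \<mu> k
    using insert.hyps by (intro prod.cong) auto
  have "(\<Sum>i\<in>insert x I. a i) ^ q =
      (\<Sum>k\<le>q. of_nat (q choose k) * a x ^ k * (\<Sum>i\<in>I. a i) ^ (q - k))"
    using insert.hyps by (simp add: binomial_ring)
  also have "\<dots> = (\<Sum>k\<le>q. \<Sum>\<mu>\<in>?W (q - k).
      fps_const (fact q / (fact k * (\<Prod>i\<in>I. fact (\<mu> i)))) * (a x ^ k * (\<Prod>i\<in>I. a i ^ \<mu> i)))"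
    unfolding insert.IH sum_distrib_left
  proof (intro sum.cong refl)
    fix k \<mu> assume "k \<in> {..q}"
    then have "of_nat (q choose k) * (fact (q - k) / (\<Prod>i\<in>I. fact (\<mu> i)))
        = (fact q / (fact k * (\<Prod>i\<in>I. fact (\<mu> i))) :: 'a)"
      by (simp add: binomial_fact)
    then have "fps_const (fact q / (fact k * (\<Prod>i\<in>I. fact (\<mu> i)))) =
        of_nat (q choose k) * fps_const (fact (q - k) / (\<Prod>i\<in>I. fact (\<mu> i)) :: 'a)"
      by (simp add: fps_of_nat[symmetric])
    then show "of_nat (q choose k) * a x ^ k *
        (fps_const (fact (q - k) / (\<Prod>i\<in>I. fact (\<mu> i))) * (\<Prod>i\<in>I. a i ^ \<mu> i)) =
        fps_const (fact q / (fact k * (\<Prod>i\<in>I. fact (\<mu> i)))) * (a x ^ k * (\<Prod>i\<in>I. a i ^ \<mu> i))"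
      by (simp only: mult_ac)
  qed
  also have "\<dots> = (\<Sum>\<mu>\<in>weighted_tuples (insert x I) (\<lambda>_. 1) q.
       fps_const (fact q / (\<Prod>i\<in>insert x I. fact (\<mu> i))) * (\<Prod>i\<in>insert x I. a i ^ \<mu> i))"
    by (simp only: sum_weighted_tuples_insert[OF insert.hyps] prod.insert[OF insert.hyps] fun_upd_same
        upd[of "\<lambda>j i. fact j"] upd[of "\<lambda>j i. a i ^ j"])
  finally show ?case .
qed

text \<open>Each multinomial term is now a monomial of degree equal to the weight of its tuple.
  Selecting weight \<open>n\<close> among the tuples of total \<open>q\<close> is the same as
  selecting total \<open>q\<close> among the tuples of weight \<open>n\<close>.\<close>

lemma fps_power_nth_weighted_tuples:
  fixes c :: "nat \<Rightarrow> 'a::field_char_0"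
  assumes I: "finite I" and w: "\<And>i. i \<in> I \<Longrightarrow> w i > 0"
  shows "((\<Sum>i\<in>I. fps_const (c i) * fps_X ^ w i) ^ q) $ n =
    (\<Sum>\<mu> | \<mu> \<in> weighted_tuples I w n \<and> (\<Sum>i\<in>I. \<mu> i) = q.
       fact q / (\<Prod>i\<in>I. fact (\<mu> i)) * (\<Prod>i\<in>I. c i ^ \<mu> i))"
proof -
  have const_prod: "fps_const (\<Prod>i\<in>I. f i) = (\<Prod>i\<in>I. fps_const (f i))" for f :: "nat \<Rightarrow> 'a"
    using I by induction (auto simp flip: fps_const_mult)
  have mono: "(\<Prod>i\<in>I. (fps_const (c i) * fps_X ^ w i) ^ \<mu> i) =
      fps_const (\<Prod>i\<in>I. c i ^ \<mu> i) * fps_X ^ (\<Sum>i\<in>I. \<mu> i * w i)" for \<mu>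
    by (simp add: power_mult_distrib prod.distrib power_sum mult.commute
        const_prod flip: power_mult)
  have "((\<Sum>i\<in>I. fps_const (c i) * fps_X ^ w i) ^ q) $ n =
    (\<Sum>\<mu>\<in>weighted_tuples I (\<lambda>_. 1) q. if (\<Sum>i\<in>I. \<mu> i * w i) = n then
       fact q / (\<Prod>i\<in>I. fact (\<mu> i)) * (\<Prod>i\<in>I. c i ^ \<mu> i) else 0)"
    unfolding fps_multinomial[OF I] mono fps_sum_nth
    by (intro sum.cong) (auto simp: mult.assoc[symmetric] fps_X_power_nth)
  also have "\<dots> = (\<Sum>\<mu> | \<mu> \<in> weighted_tuples I w n \<and> (\<Sum>i\<in>I. \<mu> i) = q.
       fact q / (\<Prod>i\<in>I. fact (\<mu> i)) * (\<Prod>i\<in>I. c i ^ \<mu> i))"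
    unfolding sum.inter_filter[OF finite_weighted_tuples[OF I zero_less_one], symmetric]
    by (intro sum.cong refl) (auto simp: weighted_tuples_def)
  finally show ?thesis .
qed

text \<open>The coefficient is the sum over \<open>q\<close> of \<open>F $ q\<close> times
  \<open>(s ^ q) $ n\<close>; the tuples of weight \<open>n\<close>, grouped by their total
  \<open>q\<close>, merge these sums into one.\<close>

lemma fps_compose_nth_weighted_tuples:
  fixes F s :: "'a::field_char_0 fps"
  assumes I: "finite I" and w: "\<And>i. i \<in> I \<Longrightarrow> w i > 0"
    and s: "\<And>k. k \<le> n \<Longrightarrow> s $ k = (\<Sum>i\<in>I. fps_const (c i) * fps_X ^ w i) $ k"
  shows "(F oo s) $ n =
    (\<Sum>\<mu>\<in>weighted_tuples I w n. let q = (\<Sum>i\<in>I. \<mu> i) in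
       fact q * F $ q / (\<Prod>i\<in>I. fact (\<mu> i)) * (\<Prod>i\<in>I. c i ^ \<mu> i))"
proof -
  \<comment> \<open>Positive weights bound the total by \<open>n\<close>, so the groups
    \<open>0..n\<close> exhaust all tuples.\<close>
  have le: "(\<lambda>\<mu>. \<Sum>i\<in>I. \<mu> i) ` weighted_tuples I w n \<subseteq> {0..n}"
  proof clarify
    fix \<mu> assume \<mu>: "\<mu> \<in> weighted_tuples I w n"
    have "(\<Sum>i\<in>I. \<mu> i) \<le> (\<Sum>i\<in>I. \<mu> i * w i)"
      using w by (intro sum_mono) (simp add: Suc_le_eq)
    then show "(\<Sum>i\<in>I. \<mu> i) \<in> {0..n}"
      using \<mu> by (simp add: weighted_tuples_def)
  qed
  have "(F oo s) $ n = (\<Sum>q=0..n. F $ q * ((\<Sum>i\<in>I. fps_const (c i) * fps_X ^ w i) ^ q) $ n)"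
    using fps_power_nth_cong[OF s order_refl] by (simp add: fps_compose_nth)
  also have "\<dots> = (\<Sum>q=0..n. \<Sum>\<mu> | \<mu> \<in> weighted_tuples I w n \<and> (\<Sum>i\<in>I. \<mu> i) = q.
      let q = (\<Sum>i\<in>I. \<mu> i) in
       fact q * F $ q / (\<Prod>i\<in>I. fact (\<mu> i)) * (\<Prod>i\<in>I. c i ^ \<mu> i))"
    by (intro sum.cong refl)
      (simp add: fps_power_nth_weighted_tuples[OF I w] sum_distrib_left mult_ac)
  also have "\<dots> = (\<Sum>\<mu>\<in>weighted_tuples I w n. let q = (\<Sum>i\<in>I. \<mu> i) in
       fact q * F $ q / (\<Prod>i\<in>I. fact (\<mu> i)) * (\<Prod>i\<in>I. c i ^ \<mu> i))"
    by (rule sum.group[OF finite_weighted_tuples[OF I w] _ le]) auto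
  finally show ?thesis .
qed

section \<open>Coefficients of the powers of x + sqrt(x^2 + 1)\<close>

text \<open>The first factor of the longer product is \<open>m + q\<close>, the last is
  \<open>m - q\<close>, and those between are the factors for \<open>q\<close> shifted by one. The
  case \<open>q = 0\<close> differs: \<open>p_poly 0 m = m\<close>, but \<open>p_poly 2 m\<close> is
  the square of \<open>m\<close>.\<close>

lemma p_poly_Suc_Suc:
  "q \<ge> 1 \<Longrightarrow> p_poly (Suc (Suc q)) m = (m\<^sup>2 - of_nat q ^ 2) * p_poly q m"
proof -
  assume "q \<ge> 1"
  have "(\<Prod>i=1..<Suc (Suc q). m + of_nat (Suc (Suc q)) - 2 * of_nat i) =
      (m + of_nat q) * (\<Prod>i=Suc 1..<Suc (Suc q). m + of_nat (Suc (Suc q)) - 2 * of_nat i)"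
    by (subst prod.atLeast_Suc_lessThan) auto
  also have "\<dots> = (m + of_nat q) * (\<Prod>i=1..<Suc q. m + of_nat q - 2 * of_nat i)"
    by (subst prod.shift_bounds_Suc_ivl) (intro arg_cong2[where f = "(*)"] prod.cong; simp)
  also have "(\<Prod>i=1..<Suc q. m + of_nat q - 2 * of_nat i) =
      (\<Prod>i=1..<q. m + of_nat q - 2 * of_nat i) * (m - of_nat q)"
    using \<open>q \<ge> 1\<close> by simp
  finally show ?thesis
    unfolding p_poly_def by (simp only:) (simp add: power2_eq_square algebra_simps)
qed

text \<open>
  The series \<open>x + \<surd>(x\<^sup>2 + 1)\<close> is \<open>exp (arsinh x)\<close>, so its \<open>m\<close>th power \<open>F\<close> solves
  \<open>(1 + x\<^sup>2) F'' + x F' = m\<^sup>2 F\<close>, a two-step recurrence for the coefficients.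
\<close>

lemma fps_exp_arsinh_power_ODE:
  fixes F :: "'a::field_char_0 fps"
  assumes F: "F = (fps_X + fps_sqrt (fps_X\<^sup>2 + 1)) ^ m"
  shows "(1 + fps_X\<^sup>2) * fps_deriv (fps_deriv F) + fps_X * fps_deriv F = of_nat (m\<^sup>2) * F"
proof -
  define R :: "'a fps" where "R = fps_sqrt (fps_X\<^sup>2 + 1)"
  define H where "H = fps_X + R"
  have R2: "R * R = fps_X\<^sup>2 + 1"
    using fps_sqrt_power2[of "fps_X\<^sup>2 + 1 :: 'a fps"] by (simp add: R_def power2_eq_square)
  have "fps_deriv (R * R) = 2 * fps_X"
    unfolding R2 by (simp add: power2_eq_square)
  then have "2 * (R * fps_deriv R) = 2 * fps_X"
    by (simp add: algebra_simps)
  then have RR': "R * fps_deriv R = fps_X"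
    by simp
  \<comment> \<open>\<open>R * fps_deriv H = R * (1 + fps_deriv R) = R + fps_X\<close>, so no
    division by \<open>R\<close> is required.\<close>
  have RH': "R * fps_deriv H = H"
    using RR' by (simp add: H_def algebra_simps)
  have F': "F = H ^ m"
    by (simp add: F H_def R_def)
  have RF': "R * fps_deriv F = of_nat m * F"
  proof (cases m)
    case (Suc k)
    have "R * fps_deriv F = of_nat m * (R * fps_deriv H) * H ^ k"
      by (simp only: F' fps_deriv_power' Suc diff_Suc_1 mult_ac)
    then show ?thesis
      by (simp add: RH' F' Suc mult_ac)
  qed (simp add: F')
  \<comment> \<open>Differentiating and multiplying by \<open>R\<close> once more leaves
    \<open>R\<close> only in \<open>R * fps_deriv R\<close>, \<open>R * R\<close> and
    \<open>R * fps_deriv F\<close>, all of which are known; the root disappears.\<close>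
  then have "fps_deriv (R * fps_deriv F) = of_nat m * fps_deriv F"
    by simp
  then have "R * (fps_deriv R * fps_deriv F + R * fps_deriv (fps_deriv F)) = of_nat m * (R * fps_deriv F)"
    by (simp add: algebra_simps)
  then have "(R * fps_deriv R) * fps_deriv F + (R * R) * fps_deriv (fps_deriv F) = of_nat m * (R * fps_deriv F)"
    by (simp add: algebra_simps)
  then show ?thesis
    unfolding RR' R2 RF' by (simp add: algebra_simps power2_eq_square)
qed

text \<open>Both sides satisfy the same two-step recurrence and agree at 1 and 2. At
  \<open>q = 0\<close> the coefficient is 1, whereas \<open>p_poly 0 m\<close> is
  \<open>m\<close>.\<close>

lemma fps_exp_arsinh_power_nth:
  assumes "q \<ge> 1"
  shows "fact q * ((fps_X + fps_sqrt (fps_X\<^sup>2 + 1)) ^ m) $ q = (p_poly q (of_nat m) :: 'a::field_char_0)"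
proof -
  define F :: "'a fps" where "F = (fps_X + fps_sqrt (fps_X\<^sup>2 + 1)) ^ m"
  note ODE = fps_exp_arsinh_power_ODE[OF F_def]
  have F0: "F $ 0 = 1"
    by (simp add: F_def fps_power_zeroth fps_sqrt_nth_0)
  have sq1: "fps_sqrt (fps_X\<^sup>2 + 1) $ 1 = (0 :: 'a)"
  proof -
    have "((fps_sqrt (fps_X\<^sup>2 + 1))\<^sup>2 :: 'a fps) $ 1 = (fps_X\<^sup>2 + 1) $ 1"
      by (subst fps_sqrt_power2) auto
    then show ?thesis
      by (simp add: power2_eq_square fps_mult_nth_1 fps_sqrt_nth_0)
  qed
  have F1: "F $ 1 = of_nat m"
    using fps_power_first_eq[of "fps_X + fps_sqrt (fps_X\<^sup>2 + 1) :: 'a fps" m] sq1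
    by (simp add: F_def fps_sqrt_nth_0)
  have rec: "of_nat (Suc (Suc k)) * of_nat (Suc k) * F $ Suc (Suc k) =
      ((of_nat m)\<^sup>2 - of_nat k ^ 2) * F $ k" for k
  proof -
    have "((1 + fps_X\<^sup>2) * fps_deriv (fps_deriv F) + fps_X * fps_deriv F) $ k = (of_nat (m\<^sup>2) * F) $ k"
      unfolding ODE ..
    moreover have "(of_nat (m\<^sup>2) * F) $ k = (of_nat m)\<^sup>2 * F $ k"
      by (simp add: fps_of_nat[symmetric])
    moreover have "((1 + fps_X\<^sup>2) * fps_deriv (fps_deriv F) + fps_X * fps_deriv F) $ k =
        of_nat (Suc (Suc k)) * of_nat (Suc k) * F $ Suc (Suc k) + of_nat k ^ 2 * F $ k"
    \<comment> \<open>The second derivative contributes \<open>k * (k - 1) * F $ k\<close> and the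
      first \<open>k * F $ k\<close>, in total \<open>k ^ 2 * F $ k\<close>. The indices 0 and 1 are
      separate because multiplication by \<open>fps_X ^ 2\<close> yields 0 there.\<close>
    proof (cases k)
      case (Suc j)
      then show ?thesis
        by (cases j) (simp_all add: distrib_right fps_X_power_mult_nth power2_eq_square algebra_simps mult.assoc)
    qed (simp add: distrib_right fps_X_power_mult_nth)
    ultimately show ?thesis
      by (simp add: algebra_simps)
  qed
  have "fact q * F $ q = p_poly q (of_nat m)"
    using assms
  proof (induction q rule: less_induct)
    case (less q)
    consider "q = 1" | "q = 2" | k where "k \<ge> 1" "q = Suc (Suc k)"
      using less.prems by (metis One_nat_def Suc_1 Suc_le_eq not_less_eq_eq le_add_diff_inverse plus_1_eq_Suc
          le_antisym)
    then show ?case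
    proof cases
      case 1
      then show ?thesis by (simp add: p_poly_def F1[unfolded One_nat_def])
    next
      case 2
      then show ?thesis
        using rec[of 0] F0 by (simp add: p_poly_def numeral_2_eq_2 power2_eq_square)
    next
      case (3 k)
      have "fact q * F $ q = fact k * (of_nat (Suc (Suc k)) * of_nat (Suc k) * F $ Suc (Suc k))"
        by (simp add: 3 algebra_simps)
      also have "\<dots> = ((of_nat m)\<^sup>2 - of_nat k ^ 2) * (fact k * F $ k)"
        unfolding rec by (simp only: mult_ac)
      also have "\<dots> = p_poly q (of_nat m)"
        using less.IH[of k] 3 by (simp add: p_poly_Suc_Suc)
      finally show ?thesis .
    qed
  qed
  then show ?thesis
    by (simp add: F_def)
qed

text \<open>
  Lagrange inversion. Expanding \<open>G\<^sup>m = A\<^sup>m(x G)\<close> expresses the \<open>n\<close>th coefficient of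
  \<open>G\<^sup>m\<close> through lower coefficients of powers of \<open>G\<close>; the induction hypothesis turns this sum
  into the coefficient of \<open>x (A\<^sup>m)' A\<^sup>n\<close>.
\<close>

lemma A_sequence_power_nth:
  fixes G A :: "'a::field_char_0 fps"
  assumes A: "G = A oo (fps_X * G)" and G0: "G $ 0 = 1" and "m \<ge> 1"
  shows "of_nat (m + n) * (G ^ m) $ n = of_nat m * (A ^ (m + n)) $ n"
  using \<open>m \<ge> 1\<close>
proof (induction n arbitrary: m rule: less_induct)
  case (less n)
  have A0: "A $ 0 = 1"
    using G0 by (subst (asm) A) simp
  show ?case
  proof (cases "n = 0")
    case True
    then show ?thesis
      using A0 G0 by (simp add: fps_power_zeroth)
  next
    case False
    have "G ^ m = (A oo (fps_X * G)) ^ m"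
      using A by simp
    also have "\<dots> = A ^ m oo (fps_X * G)"
      by (simp add: fps_compose_power)
    finally have "(G ^ m) $ n = (\<Sum>j=0..n. (A ^ m) $ j * (G ^ j) $ (n - j))"
      by (auto simp: fps_compose_nth power_mult_distrib fps_X_power_mult_nth intro!: sum.cong)
    then have "of_nat n * (G ^ m) $ n = (\<Sum>j=0..n. (A ^ m) $ j * (of_nat n * (G ^ j) $ (n - j)))"
      by (simp add: sum_distrib_left mult_ac)
    also have "\<dots> = (\<Sum>j=0..n. (A ^ m) $ j * (of_nat j * (A ^ n) $ (n - j)))"
    proof (rule sum.cong[OF refl], rule arg_cong[where f = "(*) _"])
      fix j assume j: "j \<in> {0..n}"
      show "of_nat n * (G ^ j) $ (n - j) = of_nat j * (A ^ n) $ (n - j)"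
      \<comment> \<open>The induction hypothesis for index \<open>n - j\<close> and exponent
        \<open>j\<close> has sum \<open>n\<close>, but requires a positive exponent. For
        \<open>j = 0\<close> both sides are 0, since \<open>n > 0\<close>.\<close>
      proof (cases "j = 0")
        case True
        then show ?thesis using False by simp
      next
        case False
        then show ?thesis using less.IH[of "n - j" j] j by simp
      qed
    qed
    also have "\<dots> = (fps_X * fps_deriv (A ^ m) * A ^ n) $ n"
      by (auto simp: fps_mult_nth[of _ "A ^ n"] gr0_conv_Suc intro!: sum.cong)
    finally have *: "of_nat n * (G ^ m) $ n = (fps_X * fps_deriv (A ^ m) * A ^ n) $ n" .
    obtain k where k: "m = Suc k"
      using less.prems by (cases m) auto
    \<comment> \<open>Both sides equal \<open>m * (m + n)\<close> times
      \<open>x A' A^(m+n-1)\<close>. Comparing coefficients then gives the claim multiplied by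
      \<open>n\<close>, which is nonzero.\<close>
    have "of_nat (m + n) * (fps_X * fps_deriv (A ^ m) * A ^ n) =
        of_nat m * (fps_X * fps_deriv (A ^ (m + n)))"
      by (simp only: fps_deriv_power' k power_add add_Suc diff_Suc_1 mult_ac)
    then have "(fps_const (of_nat (m + n)) * (fps_X * fps_deriv (A ^ m) * A ^ n)) $ n =
        (fps_const (of_nat m) * (fps_X * fps_deriv (A ^ (m + n)))) $ n"
      by (simp only: fps_of_nat)
    then have "of_nat (m + n) * (of_nat n * (G ^ m) $ n) = of_nat m * (of_nat n * (A ^ (m + n)) $ n)"
      unfolding fps_mult_left_const_nth *[symmetric] using False by (simp add: gr0_conv_Suc)
    then show ?thesis
      using False by (simp add: mult.left_commute[of _ "of_nat n"])
  qed
qed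

section \<open>From the B-sequence of g to the A-sequence of its square root\<close>

text \<open>Substitution commutes with the square root, since a root with constant term 1 is unique.
  Powers of \<open>h\<close> thereby become powers of one fixed series, composed with
  \<open>s\<close>.\<close>

lemma fps_exp_arsinh_compose:
  fixes s :: "'a::field_char_0 fps"
  assumes s0: "s $ 0 = 0"
  shows "s + fps_sqrt (s\<^sup>2 + 1) = (fps_X + fps_sqrt (fps_X\<^sup>2 + 1)) oo s"
proof -
  have "(fps_sqrt (fps_X\<^sup>2 + 1) oo s)\<^sup>2 = s\<^sup>2 + 1"
    using s0 by (simp add: fps_compose_power fps_sqrt_power2 fps_compose_add_distrib
        flip: fps_compose_power[of s fps_X])
  then have "fps_sqrt (fps_X\<^sup>2 + 1) oo s = fps_sqrt (s\<^sup>2 + 1)"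
    by (rule fps_sqrt_unique) (simp add: fps_sqrt_nth_0)
  then show ?thesis
    using s0 by (simp add: fps_compose_add_distrib)
qed

lemma B_sequence_sqrt_A_sequence:
  fixes g B s :: "'a::field_char_0 fps"
  assumes B: "is_B_sequence g B" and s: "2 * s = fps_X * (B oo fps_X\<^sup>2)"
  shows "is_A_sequence (fps_sqrt g) (s + fps_sqrt (s\<^sup>2 + 1))"
proof -
  define r where "r = fps_sqrt g"
  define u where "u = fps_X * r"
  define \<sigma> where "\<sigma> = s oo u"
  have g: "g = 1 + fps_X * g * (B oo (fps_X\<^sup>2 * g))"
    using B by (simp add: is_B_sequence_def)
  have "g $ 0 = 1"
    by (subst g) simp
  then have r2: "r\<^sup>2 = g"
    by (simp add: r_def fps_sqrt_power2)
  have r0: "r $ 0 = 1"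
    by (simp add: r_def fps_sqrt_nth_0)
  have u0: "u $ 0 = 0"
    by (simp add: u_def)
  have u2: "fps_X\<^sup>2 oo u = fps_X\<^sup>2 * g"
    using u0 by (simp add: u_def r2 power_mult_distrib flip: fps_compose_power)
  have "2 * \<sigma> = (2 * s) oo u"
    using u0 by (simp add: \<sigma>_def fps_compose_mult_distrib)
  also have "\<dots> = u * (B oo (fps_X\<^sup>2 * g))"
    using u0 by (simp add: s fps_compose_mult_distrib u2 flip: fps_compose_assoc)
  finally have "2 * \<sigma> * r = fps_X * g * (B oo (fps_X\<^sup>2 * g))"
    by (simp add: u_def r2[symmetric] power2_eq_square mult_ac)
  with g r2 have "r\<^sup>2 = 1 + 2 * \<sigma> * r"
    by metis
  \<comment> \<open>Completing the square; the constant term 1 of \<open>r - \<sigma>\<close> then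
    selects the branch of the root.\<close>
  then have "(r - \<sigma>)\<^sup>2 = \<sigma>\<^sup>2 + 1"
    by (simp add: power2_eq_square algebra_simps)
  moreover have s0: "s $ 0 = 0"
  proof -
    have "(2 * s) $ 0 = 0"
      unfolding s by simp
    then show ?thesis by simp
  qed
  ultimately have "r - \<sigma> = fps_sqrt (\<sigma>\<^sup>2 + 1)"
    by (intro fps_sqrt_unique) (simp_all add: \<sigma>_def r0)
  then have "r = \<sigma> + fps_sqrt (\<sigma>\<^sup>2 + 1)"
    by (simp add: algebra_simps)
  also have "\<dots> = (s + fps_sqrt (s\<^sup>2 + 1)) oo u"
  \<comment> \<open>Both sides are substitutions into x + sqrt(x^2 + 1), so associativity of
    composition identifies them.\<close>
  proof -
    have "\<sigma> $ 0 = 0"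
      using s0 by (simp add: \<sigma>_def)
    then have "\<sigma> + fps_sqrt (\<sigma>\<^sup>2 + 1) = (fps_X + fps_sqrt (fps_X\<^sup>2 + 1)) oo (s oo u)"
      unfolding \<sigma>_def by (rule fps_exp_arsinh_compose)
    then show ?thesis
      unfolding fps_exp_arsinh_compose[OF s0] fps_compose_assoc[OF u0 s0] .
  qed
  finally show ?thesis
    using r0 by (simp add: is_A_sequence_def u_def flip: r_def)
qed

section \<open>The expansions in terms of the B-sequence\<close>

lemma exp_arsinh_power_nth_weighted_tuples:
  fixes b :: "nat \<Rightarrow> 'a::field_char_0"
  assumes "n \<ge> 1"
    and s: "s = Abs_fps (\<lambda>k. if odd k then b (k div 2) / 2 else 0)"
    and p: "p = (n - 1) div 2"
  shows "((s + fps_sqrt (s\<^sup>2 + 1)) ^ m) $ n =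
    (\<Sum>\<mu>\<in>weighted_tuples {..p} (\<lambda>i. 2 * i + 1) n.
       p_poly (\<Sum>i\<le>p. \<mu> i) (of_nat m) / (\<Prod>i\<le>p. fact (\<mu> i)) * (\<Prod>i\<le>p. (b i / 2) ^ \<mu> i))"
proof -
  let ?w = "\<lambda>i::nat. 2 * i + 1"
  have s0: "s $ 0 = 0"
    by (simp add: s)
  \<comment> \<open>\<open>2 * p + 1\<close> is the largest odd number not exceeding
    \<open>n\<close>, so the truncation keeps every term of \<open>s\<close> of degree at most
    \<open>n\<close>.\<close>
  have trunc: "s $ k = (\<Sum>i\<le>p. fps_const (b i / 2) * fps_X ^ ?w i) $ k" if "k \<le> n" for k
  proof -
    have "(\<Sum>i\<le>p. fps_const (b i / 2) * fps_X ^ ?w i) $ k =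
        (\<Sum>i\<le>p. if k = ?w i then b i / 2 else 0)"
      by (simp add: fps_sum_nth fps_X_power_nth del: power_Suc)
        (intro sum.cong refl, auto)
    also have "\<dots> = s $ k"
    proof (cases "odd k")
      case True
      then obtain j where j: "k = 2 * j + 1"
        by (elim oddE)
      moreover have "j \<le> p"
        using j that p by linarith
      moreover have "(\<Sum>i\<le>p. if k = ?w i then b i / 2 else 0) = (\<Sum>i\<le>p. if i = j then b i / 2 else 0)"
        using j by (intro sum.cong) auto
      ultimately show ?thesis
        by (simp add: s)
    next
      case False
      then show ?thesis
        by (auto simp: s intro!: sum.neutral)
    qed
    finally show ?thesis ..
  qed
  have pos: "(\<Sum>i\<le>p. \<mu> i) \<ge> 1" if "\<mu> \<in> weighted_tuples {..p} ?w n" for \<mu>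
  proof (rule ccontr)
    assume "\<not> (\<Sum>i\<le>p. \<mu> i) \<ge> 1"
    then have "\<forall>i\<le>p. \<mu> i = 0"
      by (auto simp: not_le)
    then show False
      using that \<open>n \<ge> 1\<close> by (auto simp: weighted_tuples_def)
  qed
  have "(s + fps_sqrt (s\<^sup>2 + 1)) ^ m = (fps_X + fps_sqrt (fps_X\<^sup>2 + 1)) ^ m oo s"
    using s0 by (simp add: fps_exp_arsinh_compose[of s] fps_compose_power)
  then have "((s + fps_sqrt (s\<^sup>2 + 1)) ^ m) $ n =
    (\<Sum>\<mu>\<in>weighted_tuples {..p} ?w n. let q = (\<Sum>i\<le>p. \<mu> i) in
       fact q * ((fps_X + fps_sqrt (fps_X\<^sup>2 + 1)) ^ m) $ q / (\<Prod>i\<le>p. fact (\<mu> i)) *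
       (\<Prod>i\<le>p. (b i / 2) ^ \<mu> i))"
    using fps_compose_nth_weighted_tuples[of "{..p}" ?w n s "\<lambda>i. b i / 2", OF _ _ trunc] by simp
  also have "\<dots> = (\<Sum>\<mu>\<in>weighted_tuples {..p} ?w n.
       p_poly (\<Sum>i\<le>p. \<mu> i) (of_nat m) / (\<Prod>i\<le>p. fact (\<mu> i)) * (\<Prod>i\<le>p. (b i / 2) ^ \<mu> i))"
    by (intro sum.cong refl) (simp add: fps_exp_arsinh_power_nth[OF pos] Let_def)
  finally show ?thesis .
qed

theorem theorem7:
  fixes g B s h :: "'a::field_char_0 fps" and b :: "nat \<Rightarrow> 'a"
  assumes "g $ 0 \<noteq> 0" and "g \<noteq> -1"
    and "pseudo_involution g"
    and "B = Abs_fps b" and "is_B_sequence g B"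
    and "s = Abs_fps (\<lambda>k. if odd k then b (k div 2) / 2 else 0)"
    and "h = s + fps_sqrt (s\<^sup>2 + 1)"
  shows "is_A_sequence (fps_sqrt g) h \<and>
    (\<forall>m::nat. \<forall>n::nat. m \<ge> 1 \<longrightarrow> n \<ge> 1 \<longrightarrow>
      (let p = (n - 1) div 2; T = weighted_tuples {..p} (\<lambda>i. 2 * i + 1) n in
        (h ^ m) $ n =
          (\<Sum>\<mu>\<in>T. let q = (\<Sum>i\<le>p. \<mu> i) in
             p_poly q (of_nat m) / (\<Prod>i\<le>p. fact (\<mu> i)) * (1 / 2 ^ q) * (\<Prod>i\<le>p. b i ^ \<mu> i)) \<and>
        (fps_sqrt g ^ m) $ n =
          (\<Sum>\<mu>\<in>T. let q = (\<Sum>i\<le>p. \<mu> i) in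
             of_nat m * p_poly q (of_nat (m + n)) / (of_nat (m + n) * (\<Prod>i\<le>p. fact (\<mu> i)))
               * (1 / 2 ^ q) * (\<Prod>i\<le>p. b i ^ \<mu> i)))) \<and>
    generalized_binomial_type (1 / 2) g (\<lambda>i. 2 * i + 1) (\<lambda>i. b i / 2) p_poly"
proof -
  define r where "r = fps_sqrt g"
  let ?w = "\<lambda>i::nat. 2 * i + 1"
  have "2 * s = fps_X * (B oo fps_X\<^sup>2)"
  proof (rule fps_ext)
    fix k
    have B2: "(B oo fps_X\<^sup>2) $ j = (if even j then b (j div 2) else 0)" for j
    proof -
      have "(B oo fps_X\<^sup>2) $ j = (\<Sum>i=0..j. if j = 2 * i then b i else 0)"
        by (auto simp: fps_compose_nth assms(4) simp flip: power_mult intro!: sum.cong)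
      also have "\<dots> = (if even j then b (j div 2) else 0)"
      proof (cases "even j")
        case True
        then have "(\<Sum>i=0..j. if j = 2 * i then b i else 0) = (\<Sum>i=0..j. if i = j div 2 then b i else 0)"
          by (intro sum.cong) auto
        then show ?thesis
          using True by simp
      qed (auto intro!: sum.neutral)
      finally show ?thesis .
    qed
    have "(2 * s) $ k = 2 * s $ k"
      by (simp add: numeral_fps_const)
    then show "(2 * s) $ k = (fps_X * (B oo fps_X\<^sup>2)) $ k"
      by (cases k) (auto simp: B2 assms(6) elim!: oddE)
  qed
  then have A: "is_A_sequence r h"
    using B_sequence_sqrt_A_sequence assms(5,7) by (simp add: r_def)
  have r0: "r $ 0 = 1"
    by (simp add: r_def fps_sqrt_nth_0)
  have "g $ 0 = (1 + fps_X * g * (B oo (fps_X\<^sup>2 * g))) $ 0"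
    using assms(5) unfolding is_B_sequence_def by (rule arg_cong)
  then have g0: "g $ 0 = 1"
    by simp
  have h_nth: "(h ^ m) $ n = (\<Sum>\<mu>\<in>weighted_tuples {..(n - 1) div 2} ?w n.
      p_poly (\<Sum>i\<le>(n - 1) div 2. \<mu> i) (of_nat m) / (\<Prod>i\<le>(n - 1) div 2. fact (\<mu> i)) *
      (\<Prod>i\<le>(n - 1) div 2. (b i / 2) ^ \<mu> i))" if "n \<ge> 1" for m n
    unfolding assms(7) by (rule exp_arsinh_power_nth_weighted_tuples[OF that assms(6) refl])
  have r_nth: "(r ^ m) $ n = (\<Sum>\<mu>\<in>weighted_tuples {..(n - 1) div 2} ?w n.
      of_nat m * p_poly (\<Sum>i\<le>(n - 1) div 2. \<mu> i) (of_nat (m + n)) /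
      (of_nat (m + n) * (\<Prod>i\<le>(n - 1) div 2. fact (\<mu> i))) *
      (\<Prod>i\<le>(n - 1) div 2. (b i / 2) ^ \<mu> i))" if "m \<ge> 1" "n \<ge> 1" for m n
  proof -
    have "of_nat (m + n) * (r ^ m) $ n = of_nat m * (h ^ (m + n)) $ n"
      using A that r0 by (intro A_sequence_power_nth) (auto simp: is_A_sequence_def)
    moreover have "of_nat (m + n) \<noteq> (0 :: 'a)"
      using that by (simp del: of_nat_add)
    ultimately have "(r ^ m) $ n = of_nat m / of_nat (m + n) * (h ^ (m + n)) $ n"
      by (simp add: nonzero_eq_divide_eq mult.commute del: of_nat_add)
    then show ?thesis
      unfolding h_nth[OF that(2)] sum_distrib_left by (simp add: mult.assoc del: of_nat_add)
  qed
  have half: "(\<Prod>i\<le>p. (b i / 2) ^ \<mu> i) = 1 / 2 ^ (\<Sum>i\<le>p. \<mu> i) * (\<Prod>i\<le>p. b i ^ \<mu> i)" for p \<mu>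
    by (simp add: power_divide prod_dividef power_sum)
  have gbt: "generalized_binomial_type (1 / 2) g ?w (\<lambda>i. b i / 2) p_poly"
    unfolding generalized_binomial_type_def
  proof (intro exI[of _ h] conjI allI impI)
    show "is_A_sequence (fps_cpow g (1 / 2)) h"
      using fps_cpow_half[OF g0, of 1] A by (simp add: r_def)
    fix m n :: nat assume mn: "m \<ge> 1" "n \<ge> 1"
    have I: "{i. ?w i \<le> n} = {..(n - 1) div 2}"
      using mn by auto
    \<comment> \<open>For the parameter 1/2 the quotient of \<open>m\<close> by it is
      \<open>2 * m\<close>, so the claim on \<open>g ^ m\<close> is the expansion of
      \<open>r\<close> with exponent \<open>2 * m\<close>.\<close>
    have "g ^ m = r ^ (2 * m)"
      using g0 by (simp add: r_def power_mult fps_sqrt_power2)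
    moreover have "of_nat m / (1 / 2) = (of_nat (2 * m) :: 'a)"
      by simp
    ultimately show "let I = {i. ?w i \<le> n} in
           (h ^ m) $ n =
             (\<Sum>\<mu>\<in>weighted_tuples I ?w n.
                p_poly (\<Sum>i\<in>I. \<mu> i) (of_nat m) / (\<Prod>i\<in>I. fact (\<mu> i)) * (\<Prod>i\<in>I. (b i / 2) ^ \<mu> i)) \<and>
           (g ^ m) $ n =
             (\<Sum>\<mu>\<in>weighted_tuples I ?w n.
                (of_nat m / (1 / 2)) * p_poly (\<Sum>i\<in>I. \<mu> i) (of_nat m / (1 / 2) + of_nat n) /
                ((of_nat m / (1 / 2) + of_nat n) * (\<Prod>i\<in>I. fact (\<mu> i))) * (\<Prod>i\<in>I. (b i / 2) ^ \<mu> i))"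
      using mn h_nth[of n m] r_nth[of "2 * m" n]
      by (simp only: I Let_def of_nat_add)
  qed
  show ?thesis
    using A gbt h_nth r_nth by (simp add: Let_def half mult.assoc flip: r_def)
qed

end
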